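(* Let $B$ be an infinite group with finite symmetric generating set $S_B$ such that $\mathrm{Cay}(B,S_B)$ (with base vertex $e_B$) is quasi-Hamiltonian. Then for every non-trivial finitely generated group $A$ with finite symmetric generating set $S_A$ such that $(A,S_A)$ has unbounded depth, the lamplighter group $(A\wr B, S_A\cup S_B)$ has unbounded depth.
   Context: For a group $G$ with finite symmetric generating set $S$, $\|g\|_S$ denotes the word length of $g\in G$. An element $g\in G$ is a dead end of $(G,S)$ if $\|gs\|_S\le \|g\|_S$ for all $s\in S$; its depth is the maximal $n\ge 1$ such that $\|gs_1\cdots s_k\|_S\le \|g\|_S$ for all $k\le n$ and all $s_1,\dots,s_k\in S$ (the depth is infinite if there is no maximal such $n$, which can happen only when $G$ is finite). $(G,S)$ has unbounded depth if for every $n\in\mathbb{N}$ there is a dead end of depth at least $n$ (in particular every finite group has unbounded depth). The wreath product $A\wr B$ is $\bigoplus_B A\rtimes B$, where $\bigoplus_B A$ is the group of finitely supported functions $f:B\to A$ with pointwise multiplication and $B$ acts by $(b\cdot f)(x)=f(b^{-1}x)$; so $(f,b)(f',b')=(f\,(b\cdot f'),bb')$. $B$ embeds by $b\mapsto(\mathbf 1,b)$ with $\mathbf 1$ the constant function $e_A$, and $A$ embeds by $a\mapsto(\delta^a,e_B)$ with $\delta^a(e_B)=a$ and $\delta^a(x)=e_A$ for $x\ne e_B$. Via these embeddings $S_A\cup S_B$ is a generating set of $A\wr B$. $\mathrm{Cay}(B,S)$ is the undirected, unlabeled graph with vertex set $B$ in which $g,g'$ are joined by an edge iff $g=g's$ for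 some $s\in S\cup S^{-1}$. A path in a graph is a sequence $v_1,\dots,v_n$ of not necessarily distinct vertices with consecutive ones adjacent; its length is $n$. For a graph $\Gamma$, vertices $u,v$ and a finite set $F$ of vertices, $\mathrm{TS}(u,v,F)$ is the minimal length of a path in $\Gamma$ which starts at $u$, ends at $v$ and visits all vertices of $F$. Let $\Gamma$ be an infinite, connected, locally finite graph with a fixed vertex $o$, and let $B_n$ be the ball of radius $n$ centered at $o$. $(\Gamma,o)$ is quasi-Hamiltonian if there is a family $\mathcal F$ of connected finite induced subgraphs of $\Gamma$ such that (1) $o\in F$ for every $F\in\mathcal F$; (2) for every $n\ge1$ there is $F\in\mathcal F$ with $B_n\subseteq F$; (3) there is a constant $M\ge0$ such that $\mathrm{TS}(o,x,F)\le |F|+M$ for all $F\in\mathcal F$ and all $x\in F$. *)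

theory Defs
  imports
    "HOL-Algebra.Generated_Groups"
    "HOL-Algebra.Product_Groups"
    "HOL-Library.Extended_Nat"
    "Graph_Theory.Graph_Theory"
begin

section \<open>Word length and dead ends\<close>

definition finite_symmetric_generating_set :: "('a, 'm) monoid_scheme \<Rightarrow> 'a set \<Rightarrow> bool" where
  "finite_symmetric_generating_set G S \<longleftrightarrow>
     finite S \<and> S \<subseteq> carrier G \<and> (\<forall>s\<in>S. inv\<^bsub>G\<^esub> s \<in> S) \<and> generate G S = carrier G"

definition word_value :: "('a, 'm) monoid_scheme \<Rightarrow> 'a list \<Rightarrow> 'a" where
  "word_value G ws = foldr (\<otimes>\<^bsub>G\<^esub>) ws \<one>\<^bsub>G\<^esub>"

text \<open>Intended for symmetric generating sets, so only letters of \<open>S\<close> itself are used.\<close>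

definition word_length :: "('a, 'm) monoid_scheme \<Rightarrow> 'a set \<Rightarrow> 'a \<Rightarrow> nat" where
  "word_length G S g = (LEAST n. \<exists>ws\<in>lists S. length ws = n \<and> word_value G ws = g)"

definition dead_end :: "('a, 'm) monoid_scheme \<Rightarrow> 'a set \<Rightarrow> 'a \<Rightarrow> bool" where
  "dead_end G S g \<longleftrightarrow>
     g \<in> carrier G \<and> (\<forall>s\<in>S. word_length G S (g \<otimes>\<^bsub>G\<^esub> s) \<le> word_length G S g)"

text \<open>The supremum is the maximum if the set is finite (and non-empty, as it is for a dead end),
  and \<open>\<infinity>\<close> if there is no maximum.\<close>

definition dead_end_depth :: "('a, 'm) monoid_scheme \<Rightarrow> 'a set \<Rightarrow> 'a \<Rightarrow> enat" where
  "dead_end_depth G S g =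
     (SUP n\<in>{n. 1 \<le> n \<and> (\<forall>ws\<in>lists S. length ws \<le> n \<longrightarrow>
                 word_length G S (g \<otimes>\<^bsub>G\<^esub> word_value G ws) \<le> word_length G S g)}. enat n)"

definition unbounded_depth :: "('a, 'm) monoid_scheme \<Rightarrow> 'a set \<Rightarrow> bool" where
  "unbounded_depth G S \<longleftrightarrow> (\<forall>n::nat. \<exists>g. dead_end G S g \<and> enat n \<le> dead_end_depth G S g)"

section \<open>Wreath products\<close>

text \<open>Elements of \<open>sum_group (carrier B) (\<lambda>_. A)\<close> are extensional functions, hence the restricted
  abstractions below.\<close>

definition lamp_shift :: "('b, 'm) monoid_scheme \<Rightarrow> 'b \<Rightarrow> ('b \<Rightarrow> 'a) \<Rightarrow> 'b \<Rightarrow> 'a" where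
  "lamp_shift B b f = (\<lambda>x\<in>carrier B. f (inv\<^bsub>B\<^esub> b \<otimes>\<^bsub>B\<^esub> x))"

definition wreath_product ::
  "('a, 'k) monoid_scheme \<Rightarrow> ('b, 'm) monoid_scheme \<Rightarrow> (('b \<Rightarrow> 'a) \<times> 'b) monoid" where
  "wreath_product A B =
     \<lparr>carrier = carrier (sum_group (carrier B) (\<lambda>_. A)) \<times> carrier B,
      monoid.mult = (\<lambda>(f, b) (f', b').
        (f \<otimes>\<^bsub>sum_group (carrier B) (\<lambda>_. A)\<^esub> lamp_shift B b f', b \<otimes>\<^bsub>B\<^esub> b')),
      one = (\<one>\<^bsub>sum_group (carrier B) (\<lambda>_. A)\<^esub>, \<one>\<^bsub>B\<^esub>)\<rparr>"

definition wreath_lamp ::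
  "('a, 'k) monoid_scheme \<Rightarrow> ('b, 'm) monoid_scheme \<Rightarrow> 'a \<Rightarrow> ('b \<Rightarrow> 'a) \<times> 'b" where
  "wreath_lamp A B a = (\<lambda>x\<in>carrier B. if x = \<one>\<^bsub>B\<^esub> then a else \<one>\<^bsub>A\<^esub>, \<one>\<^bsub>B\<^esub>)"

definition wreath_move ::
  "('a, 'k) monoid_scheme \<Rightarrow> ('b, 'm) monoid_scheme \<Rightarrow> 'b \<Rightarrow> ('b \<Rightarrow> 'a) \<times> 'b" where
  "wreath_move A B b = (\<one>\<^bsub>sum_group (carrier B) (\<lambda>_. A)\<^esub>, b)"

lemma lamp_shift_closed:
  assumes "group A" "group B" "b \<in> carrier B" "f \<in> carrier (sum_group (carrier B) (\<lambda>_. A))"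
  shows "lamp_shift B b f \<in> carrier (sum_group (carrier B) (\<lambda>_. A))"
proof -
  interpret B: group B by fact
  have f: "f \<in> carrier B \<rightarrow>\<^sub>E carrier A" "finite {x \<in> carrier B. f x \<noteq> \<one>\<^bsub>A\<^esub>}"
    using assms(1,4) by (auto simp: carrier_sum_group)
  have "{x \<in> carrier B. lamp_shift B b f x \<noteq> \<one>\<^bsub>A\<^esub>}
          \<subseteq> (\<lambda>y. b \<otimes>\<^bsub>B\<^esub> y) ` {x \<in> carrier B. f x \<noteq> \<one>\<^bsub>A\<^esub>}"
  proof
    fix x assume x: "x \<in> {x \<in> carrier B. lamp_shift B b f x \<noteq> \<one>\<^bsub>A\<^esub>}"
    then have "x = b \<otimes>\<^bsub>B\<^esub> (inv\<^bsub>B\<^esub> b \<otimes>\<^bsub>B\<^esub> x)"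
      using assms(3) by (simp add: B.m_assoc[symmetric])
    then show "x \<in> (\<lambda>y. b \<otimes>\<^bsub>B\<^esub> y) ` {x \<in> carrier B. f x \<noteq> \<one>\<^bsub>A\<^esub>}"
      using x assms(3) by (auto simp: lamp_shift_def)
  qed
  then have "finite {x \<in> carrier B. lamp_shift B b f x \<noteq> \<one>\<^bsub>A\<^esub>}"
    using f(2) finite_surj by blast
  moreover have "lamp_shift B b f \<in> carrier B \<rightarrow>\<^sub>E carrier A"
    using f(1) assms(3) by (auto simp: lamp_shift_def PiE_iff)
  ultimately show ?thesis
    using assms(1) by (simp add: carrier_sum_group)
qed

lemma group_wreath_product:
  assumes "group A" "group B"
  shows "group (wreath_product A B)"
proof -
  interpret A: group A by fact
  interpret B: group B by fact
  let ?S = "sum_group (carrier B) (\<lambda>_. A)"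
  interpret S: group ?S using assms by simp
  have ext: "f \<in> carrier B \<rightarrow>\<^sub>E carrier A" if "f \<in> carrier ?S" for f
    using that assms(1) by (simp add: carrier_sum_group)
  have shift_mult: "lamp_shift B b (f \<otimes>\<^bsub>?S\<^esub> g) = lamp_shift B b f \<otimes>\<^bsub>?S\<^esub> lamp_shift B b g"
    if "b \<in> carrier B" for b and f g :: "_ \<Rightarrow> 'a"
    using that by (auto simp: lamp_shift_def fun_eq_iff)
  have shift_shift: "lamp_shift B b (lamp_shift B c f) = lamp_shift B (b \<otimes>\<^bsub>B\<^esub> c) f"
    if "b \<in> carrier B" "c \<in> carrier B" for b c and f :: "_ \<Rightarrow> 'a"
    using that by (auto simp: lamp_shift_def fun_eq_iff B.inv_mult_group B.m_assoc)
  have shift_one: "lamp_shift B \<one>\<^bsub>B\<^esub> f = f" if "f \<in> carrier ?S" for f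
    using ext[OF that] by (auto simp: lamp_shift_def fun_eq_iff PiE_iff extensional_def)
  note closed = lamp_shift_closed[OF assms]
  note [simp del] = mult_sum_group one_sum_group
  show ?thesis
  proof (rule groupI)
    fix p q
    assume "p \<in> carrier (wreath_product A B)" "q \<in> carrier (wreath_product A B)"
    then show "p \<otimes>\<^bsub>wreath_product A B\<^esub> q \<in> carrier (wreath_product A B)"
      by (auto simp: wreath_product_def closed)
  next
    fix p q r
    assume "p \<in> carrier (wreath_product A B)" "q \<in> carrier (wreath_product A B)"
      "r \<in> carrier (wreath_product A B)"
    then show "p \<otimes>\<^bsub>wreath_product A B\<^esub> q \<otimes>\<^bsub>wreath_product A B\<^esub> r
               = p \<otimes>\<^bsub>wreath_product A B\<^esub> (q \<otimes>\<^bsub>wreath_product A B\<^esub> r)"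
      by (auto simp: wreath_product_def closed shift_mult shift_shift S.m_assoc B.m_assoc)
  next
    fix p
    assume "p \<in> carrier (wreath_product A B)"
    then show "\<one>\<^bsub>wreath_product A B\<^esub> \<otimes>\<^bsub>wreath_product A B\<^esub> p = p"
      by (auto simp: wreath_product_def shift_one)
  next
    fix p
    assume "p \<in> carrier (wreath_product A B)"
    then obtain f b where p: "p = (f, b)" "f \<in> carrier ?S" "b \<in> carrier B"
      by (auto simp: wreath_product_def)
    let ?f = "lamp_shift B (inv\<^bsub>B\<^esub> b) f"
    have f: "?f \<in> carrier ?S" using p by (simp add: closed)
    show "\<exists>q\<in>carrier (wreath_product A B). q \<otimes>\<^bsub>wreath_product A B\<^esub> p = \<one>\<^bsub>wreath_product A B\<^esub>"
      by (rule bexI[of _ "(inv\<^bsub>?S\<^esub> ?f, inv\<^bsub>B\<^esub> b)"])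
         (use p f in \<open>auto simp: wreath_product_def S.l_inv simp del: inv_sum_group\<close>)
  qed (auto simp: wreath_product_def)
qed

lemma wreath_lamp_hom:
  assumes "group A" "group B"
  shows "wreath_lamp A B \<in> hom A (wreath_product A B)"
proof -
  interpret A: group A by fact
  interpret B: group B by fact
  have "finite {x \<in> carrier B. x = \<one>\<^bsub>B\<^esub> \<and> P}" for P
    by (rule finite_subset[of _ "{\<one>\<^bsub>B\<^esub>}"]) auto
  then show ?thesis
    using assms(1)
    by (auto simp: hom_def wreath_lamp_def wreath_product_def lamp_shift_def carrier_sum_group
        fun_eq_iff cong: conj_cong)
qed

lemma wreath_move_hom:
  assumes "group A" "group B"
  shows "wreath_move A B \<in> hom B (wreath_product A B)"
proof -
  interpret A: group A by fact
  interpret B: group B by fact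
  show ?thesis
    using assms(1)
    by (auto simp: hom_def wreath_move_def wreath_product_def lamp_shift_def carrier_sum_group
        fun_eq_iff cong: conj_cong)
qed

lemma generate_hom_image:
  assumes "group G" "group H" "h \<in> hom G H" "S \<subseteq> carrier G" "g \<in> generate G S"
  shows "h g \<in> generate H (h ` S)"
proof -
  interpret group_hom G H h
    using assms(1-3) by (simp add: group_hom_def group_hom_axioms_def)
  show ?thesis
    using assms(4,5) generate_img[of S] by blast
qed

lemma finite_symmetric_generating_set_wreath_product:
  assumes "group A" "group B"
    and "finite_symmetric_generating_set A S" "finite_symmetric_generating_set B T"
  shows "finite_symmetric_generating_set (wreath_product A B)
           (wreath_lamp A B ` S \<union> wreath_move A B ` T)"
proof -
  let ?W = "wreath_product A B" and ?S = "sum_group (carrier B) (\<lambda>_. A)"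
  let ?U = "wreath_lamp A B ` S \<union> wreath_move A B ` T"
  interpret A: group A by fact
  interpret B: group B by fact
  interpret W: group ?W using assms(1,2) by (rule group_wreath_product)
  note homs = wreath_lamp_hom[OF assms(1,2)] wreath_move_hom[OF assms(1,2)]
  interpret l: group_hom A ?W "wreath_lamp A B"
    using homs by unfold_locales
  interpret m: group_hom B ?W "wreath_move A B"
    using homs by unfold_locales
  have S: "finite S" "S \<subseteq> carrier A" "\<forall>s\<in>S. inv\<^bsub>A\<^esub> s \<in> S" "generate A S = carrier A"
    and T: "finite T" "T \<subseteq> carrier B" "\<forall>t\<in>T. inv\<^bsub>B\<^esub> t \<in> T" "generate B T = carrier B"
    using assms(3,4) by (auto simp: finite_symmetric_generating_set_def)
  have U: "?U \<subseteq> carrier ?W" using S T by auto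
  have "inv\<^bsub>?W\<^esub> u \<in> ?U" if "u \<in> ?U" for u
    using that
  proof
    assume "u \<in> wreath_lamp A B ` S"
    then obtain s where s: "s \<in> S" "u = wreath_lamp A B s" by blast
    then have "inv\<^bsub>?W\<^esub> u = wreath_lamp A B (inv\<^bsub>A\<^esub> s)" using S(2) l.hom_inv by auto
    then show ?thesis using s S(3) by auto
  next
    assume "u \<in> wreath_move A B ` T"
    then obtain s where s: "s \<in> T" "u = wreath_move A B s" by blast
    then have "inv\<^bsub>?W\<^esub> u = wreath_move A B (inv\<^bsub>B\<^esub> s)" using T(2) m.hom_inv by auto
    then show ?thesis using s T(3) by auto
  qed
  moreover have lamp: "wreath_lamp A B a \<in> generate ?W ?U" if "a \<in> carrier A" for a
    using generate_hom_image[OF assms(1) W.is_group homs(1) S(2)] that S(4)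
      W.mono_generate[of "wreath_lamp A B ` S" ?U] by blast
  moreover have move: "wreath_move A B b \<in> generate ?W ?U" if "b \<in> carrier B" for b
    using generate_hom_image[OF assms(2) W.is_group homs(2) T(2)] that T(4)
      W.mono_generate[of "wreath_move A B ` T" ?U] by blast
  moreover have base: "(f, \<one>\<^bsub>B\<^esub>) \<in> generate ?W ?U"
    if "finite X" "f \<in> carrier ?S" "{x \<in> carrier B. f x \<noteq> \<one>\<^bsub>A\<^esub>} = X" for f X
    using that
  proof (induction X arbitrary: f rule: finite_induct)
    case empty
    then have "f = (\<lambda>x\<in>carrier B. \<one>\<^bsub>A\<^esub>)"
      using assms(1) by (auto simp: carrier_sum_group fun_eq_iff PiE_iff extensional_def)
    then have "(f, \<one>\<^bsub>B\<^esub>) = \<one>\<^bsub>?W\<^esub>" by (simp add: wreath_product_def)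
    then show ?case by (simp add: generate.one)
  next
    case (insert y X)
    have f: "f \<in> carrier B \<rightarrow>\<^sub>E carrier A" "finite {x \<in> carrier B. f x \<noteq> \<one>\<^bsub>A\<^esub>}"
      using insert.prems(1) assms(1) by (auto simp: carrier_sum_group)
    have y: "y \<in> carrier B" using insert.prems(2) by auto
    then have fy: "f y \<in> carrier A" using f(1) by auto
    define g where "g = f(y := \<one>\<^bsub>A\<^esub>)"
    have supp: "{x \<in> carrier B. g x \<noteq> \<one>\<^bsub>A\<^esub>} = X"
      using insert.prems(2) insert.hyps(2) by (auto simp: g_def)
    have g: "g \<in> carrier B \<rightarrow>\<^sub>E carrier A"
      using f(1) y by (auto simp: g_def PiE_iff extensional_def)
    have gS: "g \<in> carrier ?S"
      using g supp insert.hyps(1) assms(1) by (simp add: carrier_sum_group)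
    have arg: "inv\<^bsub>B\<^esub> y \<otimes>\<^bsub>B\<^esub> x = \<one>\<^bsub>B\<^esub> \<longleftrightarrow> x = y" if "x \<in> carrier B" for x
      using that y by (metis B.inv_closed B.inv_equality B.inv_inv B.l_inv)
    have vals: "g x \<in> carrier A" "f x \<in> carrier A" if "x \<in> carrier B" for x
      using that g f(1) by auto
    have "(f, \<one>\<^bsub>B\<^esub>) = (g, \<one>\<^bsub>B\<^esub>) \<otimes>\<^bsub>?W\<^esub>
      (wreath_move A B y \<otimes>\<^bsub>?W\<^esub> wreath_lamp A B (f y) \<otimes>\<^bsub>?W\<^esub> wreath_move A B (inv\<^bsub>B\<^esub> y))"
      using y fy f(1) arg vals
      by (auto simp: wreath_product_def wreath_move_def wreath_lamp_def lamp_shift_def g_def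
          fun_eq_iff PiE_iff extensional_def)
    moreover have "(g, \<one>\<^bsub>B\<^esub>) \<in> generate ?W ?U"
      using insert.IH[OF gS supp] .
    ultimately show ?case
      using lamp[OF fy] move[OF y] move[OF B.inv_closed[OF y]] by (metis generate.eng)
  qed
  moreover have "w \<in> generate ?W ?U" if W: "w \<in> carrier ?W" for w
  proof -
    obtain f b where w: "w = (f, b)" "f \<in> carrier ?S" "b \<in> carrier B"
      using W by (auto simp: wreath_product_def)
    have f: "f \<in> carrier B \<rightarrow>\<^sub>E carrier A" "finite {x \<in> carrier B. f x \<noteq> \<one>\<^bsub>A\<^esub>}"
      using w(2) assms(1) by (auto simp: carrier_sum_group)
    then have "w = (f, \<one>\<^bsub>B\<^esub>) \<otimes>\<^bsub>?W\<^esub> wreath_move A B b"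
      using w by (auto simp: wreath_product_def wreath_move_def lamp_shift_def fun_eq_iff
          PiE_iff extensional_def)
    then show ?thesis using base[OF f(2) w(2)] move[OF w(3)] by (metis generate.eng)
  qed
  ultimately show ?thesis
    using S(1) T(1) U W.generate_incl[OF U] by (auto simp: finite_symmetric_generating_set_def)
qed

section \<open>Cayley graphs and quasi-Hamiltonicity\<close>

text \<open>Undirected graphs are rendered as symmetric digraphs, and paths in the sense used here
  (vertices may repeat) are the vertex walks \<^const>\<open>vwalk\<close>.\<close>

definition cayley_graph :: "('b, 'm) monoid_scheme \<Rightarrow> 'b set \<Rightarrow> ('b, 'b \<times> 'b) pre_digraph" where
  "cayley_graph B S = with_proj
     \<lparr>pverts = carrier B,
      parcs = {(g, g'). g \<in> carrier B \<and> g' \<in> carrier B \<and>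
                 (\<exists>s\<in>S \<union> (\<lambda>t. inv\<^bsub>B\<^esub> t) ` S. g = g' \<otimes>\<^bsub>B\<^esub> s)}\<rparr>"

definition graph_ball :: "('v, 'e) pre_digraph \<Rightarrow> 'v \<Rightarrow> nat \<Rightarrow> 'v set" where
  "graph_ball \<Gamma> u n =
     {v. \<exists>p. vwalk p \<Gamma> \<and> hd p = u \<and> last p = v \<and> vwalk_length p \<le> n}"

text \<open>The length of a path is here the number of its vertices, i.e. \<open>length p\<close>, whereas
  \<^const>\<open>vwalk_length\<close> (used for the metric) counts edges. The value is \<open>\<infinity>\<close> if there is no
  such path.\<close>

definition TS :: "('v, 'e) pre_digraph \<Rightarrow> 'v \<Rightarrow> 'v \<Rightarrow> 'v set \<Rightarrow> enat" where
  "TS \<Gamma> u v F =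
     (INF p\<in>{p. vwalk p \<Gamma> \<and> hd p = u \<and> last p = v \<and> F \<subseteq> set p}. enat (length p))"

text \<open>Meant for infinite, connected, locally finite \<open>\<Gamma>\<close> and a vertex \<open>r\<close>; Cayley graphs of
  infinite groups with respect to finite generating sets are of this kind (see below).\<close>

definition quasi_hamiltonian :: "('v, 'e) pre_digraph \<Rightarrow> 'v \<Rightarrow> bool" where
  "quasi_hamiltonian \<Gamma> r \<longleftrightarrow>
     (\<exists>\<F>.
        (\<forall>F\<in>\<F>. induced_subgraph F \<Gamma> \<and> finite (verts F) \<and> Digraph_Component.connected F) \<and>
        (\<forall>F\<in>\<F>. r \<in> verts F) \<and>
        (\<forall>n\<ge>1. \<exists>F\<in>\<F>. graph_ball \<Gamma> r n \<subseteq> verts F) \<and>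
        (\<exists>M::nat. \<forall>F\<in>\<F>. \<forall>x\<in>verts F. TS \<Gamma> r x (verts F) \<le> enat (card (verts F) + M)))"

lemma cayley_graph_simps [simp]:
  "verts (cayley_graph B S) = carrier B"
  "arcs_ends (cayley_graph B S) = {(g, g'). g \<in> carrier B \<and> g' \<in> carrier B \<and>
     (\<exists>s\<in>S \<union> (\<lambda>t. inv\<^bsub>B\<^esub> t) ` S. g = g' \<otimes>\<^bsub>B\<^esub> s)}"
  by (auto simp: cayley_graph_def arcs_ends_def arc_to_ends_def)

lemma sym_digraph_cayley_graph:
  assumes "group B" "S \<subseteq> carrier B"
  shows "sym_digraph (cayley_graph B S)"
proof -
  interpret B: group B by fact
  have swap: "g' = g \<otimes>\<^bsub>B\<^esub> inv\<^bsub>B\<^esub> s" if "g' \<in> carrier B" "s \<in> carrier B" "g = g' \<otimes>\<^bsub>B\<^esub> s" for g g' s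
    using that by (simp add: B.m_assoc)
  have mem: "inv\<^bsub>B\<^esub> s \<in> S \<union> (\<lambda>t. inv\<^bsub>B\<^esub> t) ` S" "s \<in> carrier B"
    if "s \<in> S \<union> (\<lambda>t. inv\<^bsub>B\<^esub> t) ` S" for s
    using that assms(2) by auto
  have "symmetric (cayley_graph B S)"
    unfolding symmetric_def
  proof (rule symI)
    fix g g' assume "(g, g') \<in> arcs_ends (cayley_graph B S)"
    then obtain s where g: "g \<in> carrier B" "g' \<in> carrier B"
      and s: "s \<in> S \<union> (\<lambda>t. inv\<^bsub>B\<^esub> t) ` S" "g = g' \<otimes>\<^bsub>B\<^esub> s"
      unfolding cayley_graph_simps by blast
    have "g' = g \<otimes>\<^bsub>B\<^esub> inv\<^bsub>B\<^esub> s" using g(2) mem(2)[OF s(1)] s(2) by (rule swap)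
    then show "(g', g) \<in> arcs_ends (cayley_graph B S)"
      unfolding cayley_graph_simps using g mem(1)[OF s(1)] by blast
  qed
  moreover have "wf_digraph (cayley_graph B S)"
    by unfold_locales (auto simp: cayley_graph_def)
  ultimately show ?thesis
    by (simp add: sym_digraph_def sym_digraph_axioms_def)
qed

lemma connected_cayley_graph:
  assumes "group B" "finite_symmetric_generating_set B S"
  shows "Digraph_Component.connected (cayley_graph B S)"
proof -
  let ?C = "cayley_graph B S"
  interpret B: group B by fact
  have S: "S \<subseteq> carrier B" "generate B S = carrier B"
    using assms(2) by (auto simp: finite_symmetric_generating_set_def)
  interpret sym_digraph ?C using assms(1) S(1) by (rule sym_digraph_cayley_graph)
  have step: "(h \<otimes>\<^bsub>B\<^esub> s) \<rightarrow>\<^sup>*\<^bsub>?C\<^esub> h" if "h \<in> carrier B" "s \<in> S \<union> (\<lambda>t. inv\<^bsub>B\<^esub> t) ` S" for h s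
    using that S(1) by (intro reachable_adjI) auto
  have "(h \<otimes>\<^bsub>B\<^esub> g) \<rightarrow>\<^sup>*\<^bsub>?C\<^esub> h" if "g \<in> generate B S" "h \<in> carrier B" for g h
    using that
  proof (induction arbitrary: h rule: generate.induct)
    case one then show ?case by simp
  next
    case (incl s) then show ?case using step by auto
  next
    case (inv s) then show ?case using step by auto
  next
    case (eng g1 g2)
    have c: "g1 \<in> carrier B" "g2 \<in> carrier B" using eng.hyps S by auto
    have "(h \<otimes>\<^bsub>B\<^esub> g1 \<otimes>\<^bsub>B\<^esub> g2) \<rightarrow>\<^sup>*\<^bsub>?C\<^esub> (h \<otimes>\<^bsub>B\<^esub> g1)" using eng.IH(2) eng.prems c by simp
    also have "(h \<otimes>\<^bsub>B\<^esub> g1) \<rightarrow>\<^sup>*\<^bsub>?C\<^esub> h" using eng.IH(1) eng.prems by simp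
    finally show ?case using c eng.prems by (simp add: B.m_assoc)
  qed
  then have "(\<one>\<^bsub>B\<^esub> \<otimes>\<^bsub>B\<^esub> g) \<rightarrow>\<^sup>*\<^bsub>?C\<^esub> \<one>\<^bsub>B\<^esub>" if "g \<in> carrier B" for g
    using that S(2) by blast
  then have one: "g \<rightarrow>\<^sup>*\<^bsub>?C\<^esub> \<one>\<^bsub>B\<^esub>" "\<one>\<^bsub>B\<^esub> \<rightarrow>\<^sup>*\<^bsub>?C\<^esub> g" if "g \<in> carrier B" for g
    using that symmetric_reachable[OF sym_arcs] by auto
  have "u \<rightarrow>\<^sup>*\<^bsub>?C\<^esub> v" if "u \<in> carrier B" "v \<in> carrier B" for u v
    using one(1)[OF that(1)] one(2)[OF that(2)] by (rule reachable_trans)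
  then show ?thesis
    unfolding connected_def strongly_connected_def
    using B.one_closed by (auto simp: reachable_mk_symmetricI)
qed

lemma locally_finite_cayley_graph:
  assumes "group B" "finite_symmetric_generating_set B S"
  shows "finite {w. v \<rightarrow>\<^bsub>cayley_graph B S\<^esub> w}"
proof -
  interpret B: group B by fact
  have S: "finite S" "S \<subseteq> carrier B"
    using assms(2) by (auto simp: finite_symmetric_generating_set_def)
  have "{w. v \<rightarrow>\<^bsub>cayley_graph B S\<^esub> w} \<subseteq> (\<lambda>s. v \<otimes>\<^bsub>B\<^esub> inv\<^bsub>B\<^esub> s) ` (S \<union> (\<lambda>t. inv\<^bsub>B\<^esub> t) ` S)"
  proof
    fix w assume "w \<in> {w. v \<rightarrow>\<^bsub>cayley_graph B S\<^esub> w}"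
    then obtain s where s: "s \<in> S \<union> (\<lambda>t. inv\<^bsub>B\<^esub> t) ` S" "w \<in> carrier B" "v = w \<otimes>\<^bsub>B\<^esub> s" by auto
    then have "s \<in> carrier B" using S(2) by auto
    then have "w = v \<otimes>\<^bsub>B\<^esub> inv\<^bsub>B\<^esub> s" using s by (simp add: B.m_assoc)
    then show "w \<in> (\<lambda>s. v \<otimes>\<^bsub>B\<^esub> inv\<^bsub>B\<^esub> s) ` (S \<union> (\<lambda>t. inv\<^bsub>B\<^esub> t) ` S)" using s(1) by blast
  qed
  then show ?thesis using S(1) by (meson finite_UnI finite_imageI finite_subset)
qed

end

theory Submission
  imports Defs
begin

text \<open>The word length of \<open>(f, x)\<close> is the sum of the lengths of the lamps \<open>f y\<close> plus the number of
  edges of a shortest walk from \<open>e\<close> to \<open>x\<close> visiting the support of \<open>f\<close>. Let \<open>F\<close> be a member of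
  the quasi-Hamiltonian family containing a large ball, and let \<open>f\<close> take a deep dead end \<open>a\<close> of
  \<open>A\<close> as its value on \<open>F\<close> and be trivial elsewhere. On \<open>F\<close> the function \<open>TS(e, \<cdot>, F)\<close> takes
  values between \<open>|F|\<close> and \<open>|F| + M\<close>, so its maximum over the ball of radius \<open>kn\<close> around \<open>e\<close> can
  grow with \<open>k\<close> at most \<open>M\<close> times: for some \<open>k \<le> M\<close>, a vertex \<open>x\<close> of this ball maximises
  \<open>TS(e, \<cdot>, F)\<close> on the ball of radius \<open>(k + 1)n\<close>. Then \<open>n\<close> letters applied to \<open>(f, x)\<close>
  keep the support in \<open>F\<close>, cannot lengthen a lamp and cannot lengthen the shortest walk.\<close>

section \<open>Words and depth\<close>

context group
begin

lemma word_value_Nil [simp]: "word_value G [] = \<one>"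
  by (simp add: word_value_def)

lemma word_value_Cons [simp]: "word_value G (x # ws) = x \<otimes> word_value G ws"
  by (simp add: word_value_def)

lemma word_value_closed: "ws \<in> lists (carrier G) \<Longrightarrow> word_value G ws \<in> carrier G"
  by (induction ws) auto

lemma word_value_append:
  "xs \<in> lists (carrier G) \<Longrightarrow> ys \<in> lists (carrier G)
    \<Longrightarrow> word_value G (xs @ ys) = word_value G xs \<otimes> word_value G ys"
  by (induction xs) (auto simp: word_value_closed m_assoc)

lemma word_length_le: "ws \<in> lists S \<Longrightarrow> word_length G S (word_value G ws) \<le> length ws"
  unfolding word_length_def by (rule Least_le) blast

lemma word_length_one [simp]: "word_length G S \<one> = 0"
  using word_length_le[of "[]"] by simp

text \<open>Closure of \<open>S\<close> under inverses turns the inverse steps of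
  \<open>generate\<close> into single letters of \<open>S\<close>.\<close>

lemma generate_word:
  assumes "S \<subseteq> carrier G" "\<And>s. s \<in> S \<Longrightarrow> inv s \<in> S" "g \<in> generate G S"
  shows "\<exists>ws\<in>lists S. word_value G ws = g"
  using assms(3)
proof (induction rule: generate.induct)
  case one
  show ?case by (rule bexI[of _ "[]"]) auto
next
  case (incl h)
  then show ?case using assms(1) by (intro bexI[of _ "[h]"]) auto
next
  case (inv h)
  then show ?case using assms(1,2) by (intro bexI[of _ "[inv h]"]) auto
next
  case (eng h1 h2)
  then obtain xs ys where "xs \<in> lists S" "word_value G xs = h1" "ys \<in> lists S" "word_value G ys = h2"
    by blast
  moreover have "xs \<in> lists (carrier G)" "ys \<in> lists (carrier G)"
    using calculation assms(1) by auto
  ultimately show ?case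
    by (intro bexI[of _ "xs @ ys"]) (auto simp: word_value_append simp del: in_lists_conv_set)
qed

text \<open>Generation makes the set under the \<open>LEAST\<close> in \<open>word_length\<close>
  non-empty, so the minimum is attained by an actual word.\<close>

lemma geodesic_word:
  assumes "finite_symmetric_generating_set G S" "g \<in> carrier G"
  obtains ws where "ws \<in> lists S" "length ws = word_length G S g" "word_value G ws = g"
proof -
  have "\<exists>ws\<in>lists S. word_value G ws = g"
    using assms generate_word by (auto simp: finite_symmetric_generating_set_def)
  then have "\<exists>n. \<exists>ws\<in>lists S. length ws = n \<and> word_value G ws = g" by blast
  then have "\<exists>ws\<in>lists S. length ws = word_length G S g \<and> word_value G ws = g"
    unfolding word_length_def by (rule LeastI_ex)
  with that show thesis by blast
qed

text \<open>Eliminates the supremum in \<open>enat\<close> and the separate dead-end condition; both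
  directions pay for this by shifting \<open>n\<close> by one, which is harmless because
  \<open>n\<close> is arbitrary.\<close>

lemma unbounded_depth_iff:
  assumes "S \<subseteq> carrier G"
  shows "unbounded_depth G S \<longleftrightarrow>
    (\<forall>n. \<exists>g\<in>carrier G. \<forall>ws\<in>lists S. length ws \<le> n \<longrightarrow>
       word_length G S (g \<otimes> word_value G ws) \<le> word_length G S g)"
    (is "_ \<longleftrightarrow> (\<forall>n. \<exists>g\<in>carrier G. ?P g n)")
proof
  assume *: "unbounded_depth G S"
  show "\<forall>n. \<exists>g\<in>carrier G. ?P g n"
  proof
    fix n
    obtain g where g: "dead_end G S g" "enat (Suc n) \<le> dead_end_depth G S g"
      using * by (auto simp: unbounded_depth_def)
    \<comment> \<open>Being strictly below the supremum yields an index above \<open>n\<close> even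
      if the supremum is infinite and not attained.\<close>
    have "enat n < enat (Suc n)" by simp
    then have "enat n < dead_end_depth G S g" using g(2) by (rule order.strict_trans2)
    then obtain m where "?P g m" "n < m"
      unfolding dead_end_depth_def less_SUP_iff by auto
    then have "?P g n" by (meson less_imp_le order.trans)
    with g(1) show "\<exists>g\<in>carrier G. ?P g n" by (auto simp: dead_end_def)
  qed
next
  assume *: "\<forall>n. \<exists>g\<in>carrier G. ?P g n"
  show "unbounded_depth G S"
    unfolding unbounded_depth_def
  proof
    fix n
    \<comment> \<open>\<open>Suc n\<close> is at least 1: one-letter words are covered, and it
      belongs to the index set of the depth.\<close>
    obtain g where g: "g \<in> carrier G" "?P g (Suc n)" using * by blast
    have "word_length G S (g \<otimes> s) \<le> word_length G S g" if "s \<in> S" for s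
      using g(2)[rule_format, of "[s]"] that assms by auto
    then have "dead_end G S g" using g(1) by (simp add: dead_end_def)
    moreover have "enat (Suc n) \<le> dead_end_depth G S g"
      unfolding dead_end_depth_def by (rule SUP_upper) (use g(2) in auto)
    then have "enat n \<le> dead_end_depth G S g"
      by (rule order.trans[rotated]) simp
    ultimately show "\<exists>g. dead_end G S g \<and> enat n \<le> dead_end_depth G S g" by blast
  qed
qed

end

section \<open>Vertex walks\<close>

lemma vwalk_singleton [simp]: "vwalk [v] \<Gamma> \<longleftrightarrow> v \<in> verts \<Gamma>"
  by (auto simp: vwalk_def)

lemma vwalk_Cons_iff:
  "p \<noteq> [] \<Longrightarrow> vwalk (v # p) \<Gamma> \<longleftrightarrow> v \<in> verts \<Gamma> \<and> (v, hd p) \<in> arcs_ends \<Gamma> \<and> vwalk p \<Gamma>"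
  by (cases p) (auto simp: vwalk_def)

lemma graph_ball_mono: "m \<le> n \<Longrightarrow> graph_ball \<Gamma> r m \<subseteq> graph_ball \<Gamma> r n"
  unfolding graph_ball_def by (blast intro: order.trans)

lemma graph_ball_step:
  assumes "v \<in> graph_ball \<Gamma> r k" "(v, w) \<in> arcs_ends \<Gamma>" "w \<in> verts \<Gamma>"
  shows "w \<in> graph_ball \<Gamma> r (Suc k)"
proof -
  obtain p where p: "vwalk p \<Gamma>" "hd p = r" "last p = v" "vwalk_length p \<le> k"
    using assms(1) by (auto simp: graph_ball_def)
  then have "p \<noteq> []" by auto
  have "vwalk (p @ [w]) \<Gamma>"
    using p assms(2,3) \<open>p \<noteq> []\<close>
    by (auto simp: vwalk_def set_vwalk_arcs_snoc)
  moreover have "hd (p @ [w]) = r" "last (p @ [w]) = w" "vwalk_length (p @ [w]) \<le> Suc k"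
    using p \<open>p \<noteq> []\<close> by (auto simp: hd_append)
  ultimately show ?thesis unfolding graph_ball_def by blast
qed

text \<open>Each edge raises the distance from \<open>r\<close> by at most one, and a walk with
  \<open>length p\<close> vertices has \<open>length p - 1\<close> edges.\<close>

lemma vwalk_subset_graph_ball:
  assumes "vwalk p \<Gamma>" "hd p \<in> graph_ball \<Gamma> r k"
  shows "set p \<subseteq> graph_ball \<Gamma> r (k + (length p - 1))"
  using assms
proof (induction p arbitrary: k rule: list.induct)
  case Nil
  then show ?case by simp
next
  case (Cons v p)
  show ?case
  proof (cases "p = []")
    case True
    then show ?thesis using Cons.prems by simp
  next
    case False
    with Cons.prems have p: "(v, hd p) \<in> arcs_ends \<Gamma>" "vwalk p \<Gamma>" "v \<in> graph_ball \<Gamma> r k"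
      by (auto simp: vwalk_Cons_iff)
    have "hd p \<in> verts \<Gamma>" using p(2) False by (auto simp: vwalk_def)
    then have "set p \<subseteq> graph_ball \<Gamma> r (Suc k + (length p - 1))"
      using Cons.IH p graph_ball_step by metis
    moreover have eq: "Suc k + (length p - 1) = k + length p"
      using False by (cases p) auto
    ultimately have "set p \<subseteq> graph_ball \<Gamma> r (k + length p)" by metis
    then show ?thesis
      using p(3) graph_ball_mono[of k "k + length p" \<Gamma> r] by auto
  qed
qed

section \<open>Shortest covering walks\<close>

lemma TS_attained:
  assumes "TS \<Gamma> u v F \<noteq> \<infinity>"
  obtains p where "vwalk p \<Gamma>" "hd p = u" "last p = v" "F \<subseteq> set p" "TS \<Gamma> u v F = enat (length p)"
proof -
  let ?P = "{p. vwalk p \<Gamma> \<and> hd p = u \<and> last p = v \<and> F \<subseteq> set p}"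
  \<comment> \<open>The infimum of the empty set is infinity, so a finite value provides a walk;
    \<open>enat\<close> is well-ordered, so the infimum of a non-empty set is a minimum.\<close>
  have "?P \<noteq> {}"
    using assms by (intro notI) (simp add: TS_def top_enat_def)
  then have "TS \<Gamma> u v F \<in> (\<lambda>p. enat (length p)) ` ?P"
    unfolding TS_def by (metis (no_types, lifting) ex_in_conv image_is_empty wellorder_InfI)
  with that show thesis by blast
qed

lemma TS_le:
  "vwalk p \<Gamma> \<Longrightarrow> hd p = u \<Longrightarrow> last p = v \<Longrightarrow> F \<subseteq> set p \<Longrightarrow> TS \<Gamma> u v F \<le> enat (length p)"
  unfolding TS_def by (rule INF_lower) blast

text \<open>The lower end of the range of \<open>TS\<close>; quasi-Hamiltonicity supplies the upper
  end, larger by \<open>M\<close>.\<close>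

lemma TS_ge_card: "enat (card F) \<le> TS \<Gamma> u v F"
  unfolding TS_def
proof (rule INF_greatest)
  fix p assume "p \<in> {p. vwalk p \<Gamma> \<and> hd p = u \<and> last p = v \<and> F \<subseteq> set p}"
  then have "card F \<le> card (set p)" by (auto intro: card_mono)
  also have "\<dots> \<le> length p" by (rule card_length)
  finally show "enat (card F) \<le> enat (length p)" by simp
qed

text \<open>Whenever no vertex of \<open>D k\<close> maximises \<open>t\<close> on \<open>D (Suc k)\<close>, the maximum of \<open>t\<close> grows by at
  least one, which can happen at most \<open>M\<close> times.\<close>

lemma bounded_growth_maximum:
  fixes t :: "'v \<Rightarrow> nat"
  assumes "x\<^sub>0 \<in> D 0" "c \<le> t x\<^sub>0"
    and "\<And>k x. k \<le> Suc M \<Longrightarrow> x \<in> D k \<Longrightarrow> t x \<le> c + M"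
  shows "\<exists>k\<le>M. \<exists>x\<in>D k. \<forall>y\<in>D (Suc k). t y \<le> t x"
proof (rule ccontr)
  assume neg: "\<not> ?thesis"
  have "\<exists>x\<in>D k. c + k \<le> t x" if "k \<le> Suc M" for k
    using that
  proof (induction k)
    case 0
    then show ?case using assms(1,2) by auto
  next
    case (Suc k)
    then obtain x where x: "x \<in> D k" "c + k \<le> t x" by auto
    with neg Suc.prems obtain y where "y \<in> D (Suc k)" "t x < t y"
      by (meson Suc_le_mono not_le)
    then show ?case using x by (intro bexI[of _ y]) auto
  qed
  from this[of "Suc M"] show False using assms(3)[of "Suc M"] by fastforce
qed

section \<open>Words in wreath products as decorated walks\<close>

locale lamplighter = A: group A + B: group B
  for A :: "('a, 'k) monoid_scheme" and B :: "('b, 'm) monoid_scheme" +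
  fixes S\<^sub>A :: "'a set" and S\<^sub>B :: "'b set"
  assumes gen_A: "finite_symmetric_generating_set A S\<^sub>A"
    and gen_B: "finite_symmetric_generating_set B S\<^sub>B"
begin

abbreviation "W \<equiv> wreath_product A B"
abbreviation "U \<equiv> wreath_lamp A B ` S\<^sub>A \<union> wreath_move A B ` S\<^sub>B"
abbreviation "\<Gamma> \<equiv> cayley_graph B S\<^sub>B"

sublocale W: group W
  using A.is_group B.is_group by (rule group_wreath_product)

lemma gen_W: "finite_symmetric_generating_set W U"
  using A.is_group B.is_group gen_A gen_B by (rule finite_symmetric_generating_set_wreath_product)

lemma S_A: "S\<^sub>A \<subseteq> carrier A" and S_B: "S\<^sub>B \<subseteq> carrier B" and U: "U \<subseteq> carrier W"
  using gen_A gen_B gen_W by (auto simp: finite_symmetric_generating_set_def)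

lemma lists_S_A: "lists S\<^sub>A \<subseteq> lists (carrier A)"
  using S_A by (rule lists_mono)

lemma lists_U: "lists U \<subseteq> lists (carrier W)"
  using U by (rule lists_mono)

lemma carrier_W_iff:
  "(f, b) \<in> carrier W \<longleftrightarrow>
     f \<in> carrier B \<rightarrow>\<^sub>E carrier A \<and> finite {x \<in> carrier B. f x \<noteq> \<one>\<^bsub>A\<^esub>} \<and> b \<in> carrier B"
  by (auto simp: wreath_product_def carrier_sum_group A.is_group)

text \<open>Symmetry of \<open>S\<^sub>B\<close> allows an edge to be read in the direction in which
  letters are appended to a word.\<close>

lemma arc_iff:
  "(g, h) \<in> arcs_ends \<Gamma> \<longleftrightarrow> g \<in> carrier B \<and> h \<in> carrier B \<and> (\<exists>s\<in>S\<^sub>B. h = g \<otimes>\<^bsub>B\<^esub> s)"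
proof -
  have inv: "inv\<^bsub>B\<^esub> s \<in> S\<^sub>B" if "s \<in> S\<^sub>B" for s
    using that gen_B by (auto simp: finite_symmetric_generating_set_def)
  have "(\<exists>s\<in>S\<^sub>B. g = h \<otimes>\<^bsub>B\<^esub> s) \<longleftrightarrow> (\<exists>s\<in>S\<^sub>B. h = g \<otimes>\<^bsub>B\<^esub> s)"
    if "g \<in> carrier B" "h \<in> carrier B"
  proof -
    have "\<exists>s\<in>S\<^sub>B. y = x \<otimes>\<^bsub>B\<^esub> s" if "\<exists>s\<in>S\<^sub>B. x = y \<otimes>\<^bsub>B\<^esub> s" "y \<in> carrier B" for x y
    proof -
      from that obtain s where s: "s \<in> S\<^sub>B" "x = y \<otimes>\<^bsub>B\<^esub> s" by blast
      then have "s \<in> carrier B" using S_B by blast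
      then have "y = x \<otimes>\<^bsub>B\<^esub> inv\<^bsub>B\<^esub> s" using s that(2) by (simp add: B.m_assoc)
      then show ?thesis using inv s(1) by blast
    qed
    then show ?thesis using that by blast
  qed
  moreover have "S\<^sub>B \<union> (\<lambda>t. inv\<^bsub>B\<^esub> t) ` S\<^sub>B = S\<^sub>B" using inv by auto
  ultimately show ?thesis by auto
qed

text \<open>Shifting by \<open>b\<close> carries the lamp at the identity to \<open>b\<close>, so a
  lamp letter acts at the cursor.\<close>

lemma mult_lamp:
  assumes "(f, b) \<in> carrier W" "a \<in> carrier A"
  shows "(f, b) \<otimes>\<^bsub>W\<^esub> wreath_lamp A B a = (f(b := f b \<otimes>\<^bsub>A\<^esub> a), b)"
proof -
  have f: "f \<in> carrier B \<rightarrow>\<^sub>E carrier A" "b \<in> carrier B" using assms(1) by (auto simp: carrier_W_iff)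
  have "inv\<^bsub>B\<^esub> b \<otimes>\<^bsub>B\<^esub> x = \<one>\<^bsub>B\<^esub> \<longleftrightarrow> x = b" if "x \<in> carrier B" for x
    using that f(2) by (metis B.inv_closed B.inv_equality B.inv_inv B.l_inv)
  then show ?thesis
    using f assms(2)
    by (auto simp: wreath_product_def wreath_lamp_def lamp_shift_def fun_eq_iff PiE_iff
        extensional_def)
qed

lemma mult_move:
  assumes "(f, b) \<in> carrier W" "s \<in> carrier B"
  shows "(f, b) \<otimes>\<^bsub>W\<^esub> wreath_move A B s = (f, b \<otimes>\<^bsub>B\<^esub> s)"
  using assms
  by (auto simp: wreath_product_def carrier_sum_group A.is_group wreath_move_def lamp_shift_def
      fun_eq_iff PiE_iff extensional_def)

lemma lamp_closed: "a \<in> carrier A \<Longrightarrow> wreath_lamp A B a \<in> carrier W"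
  using wreath_lamp_hom[OF A.is_group B.is_group] by (auto simp: hom_def)

lemma move_closed: "b \<in> carrier B \<Longrightarrow> wreath_move A B b \<in> carrier W"
  using wreath_move_hom[OF A.is_group B.is_group] by (auto simp: hom_def)

text \<open>A word in \<^term>\<open>U\<close> amounts to the walk \<open>p\<close> of the cursor together with, for each vertex, the
  word \<open>ls y\<close> of all lamp letters applied while the cursor is at \<open>y\<close>.\<close>

definition decorated_walk :: "'b list \<Rightarrow> ('b \<Rightarrow> 'a list) \<Rightarrow> bool" where
  "decorated_walk p ls \<longleftrightarrow>
     vwalk p \<Gamma> \<and> (\<forall>y. ls y \<in> lists S\<^sub>A) \<and> (\<forall>y. y \<notin> set p \<longrightarrow> ls y = [])"

definition apply_lamps :: "('b \<Rightarrow> 'a) \<Rightarrow> ('b \<Rightarrow> 'a list) \<Rightarrow> 'b \<Rightarrow> 'a" where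
  "apply_lamps f ls = (\<lambda>y\<in>carrier B. f y \<otimes>\<^bsub>A\<^esub> word_value A (ls y))"

text \<open>Stated with sums on both sides to avoid truncated subtraction on
  \<open>nat\<close>.\<close>

lemma sum_fun_upd_length:
  assumes "finite Y" "b \<in> Y"
  shows "(\<Sum>y\<in>Y. length ((ls(b := l)) y)) + length (ls b) = (\<Sum>y\<in>Y. length (ls y)) + length l"
proof -
  have "(\<Sum>y\<in>Y - {b}. length ((ls(b := l)) y)) = (\<Sum>y\<in>Y - {b}. length (ls y))"
    by (rule sum.cong) auto
  then show ?thesis
    using sum.remove[OF assms, of "\<lambda>y. length (ls y)"]
      sum.remove[OF assms, of "\<lambda>y. length ((ls(b := l)) y)"] by simp
qed

text \<open>Lamp letters are counted by the sum and move letters by the edges of \<open>p\<close>;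
  the \<open>Suc\<close> accounts for the initial vertex. The start \<open>(f, b)\<close> is
  arbitrary because the induction removes the first letter of the word.\<close>

lemma word_to_decorated_walk:
  assumes "ws \<in> lists U" "(f, b) \<in> carrier W"
  shows "\<exists>p ls. decorated_walk p ls \<and> hd p = b \<and>
    (\<Sum>y\<in>set p. length (ls y)) + length p = Suc (length ws) \<and>
    (f, b) \<otimes>\<^bsub>W\<^esub> word_value W ws = (apply_lamps f ls, last p)"
  using assms
proof (induction ws arbitrary: f b rule: list.induct)
  case Nil
  have "f = apply_lamps f (\<lambda>_. [])"
    using Nil.prems by (auto simp: carrier_W_iff apply_lamps_def fun_eq_iff PiE_iff extensional_def)
  then show ?case
    using Nil.prems
    by (intro exI[of _ "[b]"] exI[of _ "\<lambda>_. []"]) (auto simp: decorated_walk_def carrier_W_iff)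
next
  case (Cons u ws)
  have b: "b \<in> carrier B" "f \<in> carrier B \<rightarrow>\<^sub>E carrier A" using Cons.prems by (auto simp: carrier_W_iff)
  have ws: "ws \<in> lists U" "word_value W ws \<in> carrier W" "u \<in> carrier W"
  proof -
    show "ws \<in> lists U" "u \<in> carrier W" using Cons.prems(1) U by auto
    then show "word_value W ws \<in> carrier W" using lists_U W.word_value_closed by blast
  qed
  have split: "(f, b) \<otimes>\<^bsub>W\<^esub> word_value W (u # ws) = (f, b) \<otimes>\<^bsub>W\<^esub> u \<otimes>\<^bsub>W\<^esub> word_value W ws"
    using ws Cons.prems(2) by (simp add: W.m_assoc)
  have closed: "(f, b) \<otimes>\<^bsub>W\<^esub> u \<in> carrier W" using ws Cons.prems(2) by simp
  from Cons.prems(1) consider s where "s \<in> S\<^sub>A" "u = wreath_lamp A B s"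
    | s where "s \<in> S\<^sub>B" "u = wreath_move A B s" by auto
  then show ?case
  proof cases
    case 1
    have s: "s \<in> carrier A" using 1 S_A by blast
    let ?f = "f(b := f b \<otimes>\<^bsub>A\<^esub> s)"
    have eq: "(f, b) \<otimes>\<^bsub>W\<^esub> u = (?f, b)" using mult_lamp Cons.prems(2) s 1 by simp
    obtain p ls where p: "decorated_walk p ls" "hd p = b"
      "(\<Sum>y\<in>set p. length (ls y)) + length p = Suc (length ws)"
      "(?f, b) \<otimes>\<^bsub>W\<^esub> word_value W ws = (apply_lamps ?f ls, last p)"
      using Cons.IH[OF ws(1)] closed eq by metis
    \<comment> \<open>The walk \<open>p\<close> starts at \<open>b\<close>, and \<open>s\<close> is
      applied before every later lamp letter there, so it goes in front.\<close>
    let ?ls = "ls(b := s # ls b)"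
    have bp: "b \<in> set p" using p(1,2) by (auto simp: decorated_walk_def)
    have val: "word_value A (ls y) \<in> carrier A" for y
      using p(1) lists_S_A A.word_value_closed unfolding decorated_walk_def by blast
    have fv: "f y \<in> carrier A" if "y \<in> carrier B" for y using that b(2) by auto
    have "decorated_walk p ?ls" using p(1) bp 1 by (auto simp: decorated_walk_def)
    moreover have "(\<Sum>y\<in>set p. length (?ls y)) + length p = Suc (length (u # ws))"
      using sum_fun_upd_length[of "set p" b ls "s # ls b"] bp p(3) by simp
    moreover have "apply_lamps ?f ls = apply_lamps f ?ls"
      using val fv s by (auto simp: apply_lamps_def fun_eq_iff A.m_assoc)
    ultimately show ?thesis using p eq split by metis
  next
    case 2
    have s: "s \<in> carrier B" using 2 S_B by blast
    have eq: "(f, b) \<otimes>\<^bsub>W\<^esub> u = (f, b \<otimes>\<^bsub>B\<^esub> s)" using mult_move Cons.prems(2) s 2 by simp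
    obtain p ls where p: "decorated_walk p ls" "hd p = b \<otimes>\<^bsub>B\<^esub> s"
      "(\<Sum>y\<in>set p. length (ls y)) + length p = Suc (length ws)"
      "(f, b \<otimes>\<^bsub>B\<^esub> s) \<otimes>\<^bsub>W\<^esub> word_value W ws = (apply_lamps f ls, last p)"
      using Cons.IH[OF ws(1)] closed eq by metis
    have ne: "p \<noteq> []" using p(1) by (auto simp: decorated_walk_def)
    have "decorated_walk (b # p) ls"
      using p ne b s 2 by (auto simp: decorated_walk_def vwalk_Cons_iff arc_iff
          simp del: cayley_graph_simps(2))
    \<comment> \<open>Either \<open>p\<close> returns to \<open>b\<close> and the vertex set is
      unchanged, or \<open>ls b\<close> is empty.\<close>
    moreover have "(\<Sum>y\<in>set (b # p). length (ls y)) = (\<Sum>y\<in>set p. length (ls y))"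
      using p(1) by (cases "b \<in> set p") (auto simp: insert_absorb decorated_walk_def)
    ultimately show ?thesis
      using p eq split ne by (intro exI[of _ "b # p"] exI[of _ ls]) auto
  qed
qed

lemma mult_lamp_word:
  assumes "l \<in> lists S\<^sub>A" "(f, b) \<in> carrier W"
  shows "(f, b) \<otimes>\<^bsub>W\<^esub> word_value W (map (wreath_lamp A B) l) = (f(b := f b \<otimes>\<^bsub>A\<^esub> word_value A l), b)"
  using assms
proof (induction l arbitrary: f rule: list.induct)
  case Nil
  then have "f b \<in> carrier A" by (auto simp: carrier_W_iff)
  with Nil show ?case by simp
next
  case (Cons s l)
  have s: "s \<in> carrier A" using Cons.prems(1) S_A by auto
  have l: "word_value A l \<in> carrier A"
    "word_value W (map (wreath_lamp A B) l) \<in> carrier W"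
  proof -
    have "l \<in> lists (carrier A)" using Cons.prems(1) S_A by auto
    then show "word_value A l \<in> carrier A" by (rule A.word_value_closed)
    show "word_value W (map (wreath_lamp A B) l) \<in> carrier W"
      using \<open>l \<in> lists (carrier A)\<close> lamp_closed by (intro W.word_value_closed) force
  qed
  note eq = mult_lamp[OF Cons.prems(2) s]
  have c: "(f(b := f b \<otimes>\<^bsub>A\<^esub> s), b) \<in> carrier W"
    using eq Cons.prems(2) s lamp_closed by (metis W.m_closed)
  have "(f, b) \<otimes>\<^bsub>W\<^esub> word_value W (map (wreath_lamp A B) (s # l))
    = (f(b := f b \<otimes>\<^bsub>A\<^esub> s), b) \<otimes>\<^bsub>W\<^esub> word_value W (map (wreath_lamp A B) l)"
    using l Cons.prems(2) s lamp_closed eq by (simp add: W.m_assoc[symmetric])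
  also have "\<dots> = (f(b := f b \<otimes>\<^bsub>A\<^esub> word_value A (s # l)), b)"
  proof -
    have "f b \<in> carrier A" using Cons.prems(2) by (auto simp: carrier_W_iff)
    moreover have "l \<in> lists S\<^sub>A" using Cons.prems(1) by auto
    ultimately show ?thesis
      using Cons.IH[OF _ c] s l(1) by (simp only: fun_upd_upd fun_upd_same A.m_assoc A.word_value_Cons)
  qed
  finally show ?case .
qed

text \<open>Converse translation at the same cost: lamps at different vertices do not interact, so
  all lamp letters of a vertex can be applied at its first visit.\<close>

lemma decorated_walk_to_word:
  assumes "decorated_walk p ls" "(f, hd p) \<in> carrier W"
  shows "\<exists>ws\<in>lists U. Suc (length ws) = (\<Sum>y\<in>set p. length (ls y)) + length p \<and>
    (f, hd p) \<otimes>\<^bsub>W\<^esub> word_value W ws = (apply_lamps f ls, last p)"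
  using assms
proof (induction p arbitrary: ls f)
  case Nil
  then show ?case by (auto simp: decorated_walk_def)
next
  case (Cons b p)
  have b: "b \<in> carrier B" "(f, b) \<in> carrier W" "f \<in> carrier B \<rightarrow>\<^sub>E carrier A"
    using Cons.prems by (auto simp: carrier_W_iff)
  have lb: "ls y \<in> lists S\<^sub>A" for y using Cons.prems by (auto simp: decorated_walk_def)
  have val: "word_value A (ls y) \<in> carrier A" for y
    using lb lists_S_A A.word_value_closed by blast
  have fv: "f y \<in> carrier A" if "y \<in> carrier B" for y using that b(3) by auto
  \<comment> \<open>The word at \<open>b\<close> is spent now and then erased, so that later visits
    to \<open>b\<close> do not repeat it.\<close>
  let ?f = "f(b := f b \<otimes>\<^bsub>A\<^esub> word_value A (ls b))" and ?ls = "ls(b := [])"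
  let ?w = "map (wreath_lamp A B) (ls b)"
  have w: "?w \<in> lists U" "word_value W ?w \<in> carrier W"
  proof -
    show "?w \<in> lists U" using lb[of b] by auto
    then show "word_value W ?w \<in> carrier W" using lists_U W.word_value_closed by blast
  qed
  note eq = mult_lamp_word[OF lb b(2), of b]
  have c: "(?f, b) \<in> carrier W" using eq b(2) w(2) by (metis W.m_closed)
  have lamps_eq: "apply_lamps f ls = apply_lamps ?f ?ls"
    using val fv by (auto simp: apply_lamps_def fun_eq_iff)
  show ?case
  proof (cases "p = []")
    case True
    have "apply_lamps f ls = ?f"
      using Cons.prems(1) b True fv
      by (auto simp: apply_lamps_def fun_eq_iff decorated_walk_def PiE_iff extensional_def)
    then show ?thesis using True w eq by (intro bexI[of _ ?w]) auto
  next
    case False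
    have p: "vwalk p \<Gamma>" "(b, hd p) \<in> arcs_ends \<Gamma>"
      using Cons.prems(1) False unfolding decorated_walk_def by (simp_all add: vwalk_Cons_iff)
    obtain s where s: "s \<in> S\<^sub>B" "hd p = b \<otimes>\<^bsub>B\<^esub> s" using p(2) unfolding arc_iff by blast
    have sc: "s \<in> carrier B" using s S_B by blast
    have mv: "(?f, b) \<otimes>\<^bsub>W\<^esub> wreath_move A B s = (?f, hd p)" using mult_move[OF c sc] s by simp
    have c': "(?f, hd p) \<in> carrier W" using mv c sc move_closed by (metis W.m_closed)
    have d: "decorated_walk p ?ls" using Cons.prems(1) p by (auto simp: decorated_walk_def)
    obtain ws where ws: "ws \<in> lists U"
      "Suc (length ws) = (\<Sum>y\<in>set p. length (?ls y)) + length p"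
      "(?f, hd p) \<otimes>\<^bsub>W\<^esub> word_value W ws = (apply_lamps ?f ?ls, last p)"
      using Cons.IH[OF d c'] by blast
    have wsc: "ws \<in> lists (carrier W)" "?w \<in> lists (carrier W)" using ws(1) w(1) lists_U by auto
    have wv: "word_value W ws \<in> carrier W" using wsc by (simp add: W.word_value_closed)
    \<comment> \<open>The lamp letters at \<open>b\<close>, one move along the first edge, then the
      word for the rest of the walk.\<close>
    let ?ws = "?w @ wreath_move A B s # ws"
    have "word_value W ?ws = word_value W ?w \<otimes>\<^bsub>W\<^esub> (wreath_move A B s \<otimes>\<^bsub>W\<^esub> word_value W ws)"
      using wsc sc move_closed by (simp add: W.word_value_append)
    then have "(f, b) \<otimes>\<^bsub>W\<^esub> word_value W ?ws
      = (f, b) \<otimes>\<^bsub>W\<^esub> word_value W ?w \<otimes>\<^bsub>W\<^esub> wreath_move A B s \<otimes>\<^bsub>W\<^esub> word_value W ws"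
      using w(2) b(2) wv sc move_closed by (simp add: W.m_assoc)
    then have "(f, b) \<otimes>\<^bsub>W\<^esub> word_value W ?ws = (apply_lamps f ls, last (b # p))"
      using eq mv ws(3) lamps_eq False by simp
    moreover have "(\<Sum>y\<in>set (b # p). length (ls y)) = length (ls b) + (\<Sum>y\<in>set p. length (?ls y))"
    proof -
      have "(\<Sum>y\<in>set (b # p). length (?ls y)) + length (ls b) = (\<Sum>y\<in>set (b # p). length (ls y))"
        using sum_fun_upd_length[of "set (b # p)" b ls "[]"] by simp
      moreover have "(\<Sum>y\<in>set (b # p). length (?ls y)) = (\<Sum>y\<in>set p. length (?ls y))"
        by (cases "b \<in> set p") (auto simp: insert_absorb)
      ultimately show ?thesis by simp
    qed
    moreover have "?ws \<in> lists U" using w(1) ws(1) s(1) by auto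
    ultimately show ?thesis using ws(2) by (intro bexI[of _ ?ws]) auto
  qed
qed

section \<open>Word length in wreath products\<close>

lemma one_W: "\<one>\<^bsub>W\<^esub> = (\<lambda>y\<in>carrier B. \<one>\<^bsub>A\<^esub>, \<one>\<^bsub>B\<^esub>)"
  by (simp add: wreath_product_def)

lemma apply_lamps_one:
  assumes "\<And>y. ls y \<in> lists S\<^sub>A"
  shows "apply_lamps (\<lambda>y\<in>carrier B. \<one>\<^bsub>A\<^esub>) ls = (\<lambda>y\<in>carrier B. word_value A (ls y))"
proof -
  have "word_value A (ls y) \<in> carrier A" for y
    using assms lists_S_A A.word_value_closed by blast
  then show ?thesis by (auto simp: apply_lamps_def fun_eq_iff)
qed

text \<open>Decorate the given walk with geodesic words for the values of \<open>f\<close> on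
  \<open>F\<close>. Here \<open>F\<close> may exceed the support: lamps in it may have become
  trivial and then cost nothing.\<close>

lemma word_length_W_upper:
  assumes "(f, x) \<in> carrier W" "F \<subseteq> carrier B" "\<And>y. y \<in> carrier B - F \<Longrightarrow> f y = \<one>\<^bsub>A\<^esub>"
    and "vwalk p \<Gamma>" "hd p = \<one>\<^bsub>B\<^esub>" "last p = x" "F \<subseteq> set p"
  shows "Suc (word_length W U (f, x)) \<le> (\<Sum>y\<in>F. word_length A S\<^sub>A (f y)) + length p"
proof -
  have f: "f y \<in> carrier A" if "y \<in> F" for y using assms(1,2) that by (auto simp: carrier_W_iff)
  have "\<exists>l. l \<in> lists S\<^sub>A \<and> length l = word_length A S\<^sub>A (f y) \<and> word_value A l = f y"
    if "y \<in> F" for y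
    using A.geodesic_word[OF gen_A f[OF that]] by blast
  then obtain l where l: "\<And>y. y \<in> F \<Longrightarrow>
      l y \<in> lists S\<^sub>A \<and> length (l y) = word_length A S\<^sub>A (f y) \<and> word_value A (l y) = f y"
    by metis
  define ls where "ls y = (if y \<in> F then l y else [])" for y
  have ls: "ls y \<in> lists S\<^sub>A" for y using l by (auto simp: ls_def)
  have "decorated_walk p ls"
    using assms(4,7) ls by (auto simp: decorated_walk_def ls_def)
  moreover have "(\<lambda>y\<in>carrier B. \<one>\<^bsub>A\<^esub>, hd p) \<in> carrier W"
    using W.one_closed assms(5) by (simp add: one_W)
  ultimately obtain ws where ws: "ws \<in> lists U"
    "Suc (length ws) = (\<Sum>y\<in>set p. length (ls y)) + length p"
    "\<one>\<^bsub>W\<^esub> \<otimes>\<^bsub>W\<^esub> word_value W ws = (\<lambda>y\<in>carrier B. word_value A (ls y), last p)"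
    using decorated_walk_to_word[of p ls "\<lambda>y\<in>carrier B. \<one>\<^bsub>A\<^esub>"]
    unfolding one_W assms(5) apply_lamps_one[OF ls] by blast
  have "(\<lambda>y\<in>carrier B. word_value A (ls y)) = f"
  proof
    fix y
    show "(\<lambda>y\<in>carrier B. word_value A (ls y)) y = f y"
      using assms(1,3) l by (cases "y \<in> F") (auto simp: carrier_W_iff ls_def PiE_iff extensional_def)
  qed
  moreover have "word_value W ws \<in> carrier W" using ws(1) lists_U W.word_value_closed by blast
  ultimately have "word_value W ws = (f, x)" using ws(3) assms(6) by simp
  then have "word_length W U (f, x) \<le> length ws" using W.word_length_le[OF ws(1)] by simp
  moreover have "(\<Sum>y\<in>set p. length (ls y)) = (\<Sum>y\<in>F. word_length A S\<^sub>A (f y))"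
    using assms(7) l by (intro sum.mono_neutral_cong_right) (auto simp: ls_def)
  ultimately show ?thesis using ws(2) by simp
qed

text \<open>Decode a geodesic word into a decorated walk. A non-trivial lamp needs a non-empty word
  at its vertex, so the walk must visit it; hence \<open>F\<close> has to lie inside the support
  here.\<close>

lemma word_length_W_lower:
  assumes "(f, x) \<in> carrier W" "F \<subseteq> {y \<in> carrier B. f y \<noteq> \<one>\<^bsub>A\<^esub>}"
  shows "\<exists>p. vwalk p \<Gamma> \<and> hd p = \<one>\<^bsub>B\<^esub> \<and> last p = x \<and> F \<subseteq> set p \<and>
    (\<Sum>y\<in>F. word_length A S\<^sub>A (f y)) + length p \<le> Suc (word_length W U (f, x))"
proof -
  obtain ws where ws: "ws \<in> lists U" "length ws = word_length W U (f, x)" "word_value W ws = (f, x)"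
    using W.geodesic_word[OF gen_W assms(1)] by blast
  obtain p ls where p: "decorated_walk p ls" "hd p = \<one>\<^bsub>B\<^esub>"
    "(\<Sum>y\<in>set p. length (ls y)) + length p = Suc (length ws)"
    "\<one>\<^bsub>W\<^esub> \<otimes>\<^bsub>W\<^esub> word_value W ws = (apply_lamps (\<lambda>y\<in>carrier B. \<one>\<^bsub>A\<^esub>) ls, last p)"
    using word_to_decorated_walk[OF ws(1) W.one_closed[unfolded one_W]] unfolding one_W by blast
  have ls: "ls y \<in> lists S\<^sub>A" for y using p(1) by (auto simp: decorated_walk_def)
  have eq: "f = (\<lambda>y\<in>carrier B. word_value A (ls y))" "x = last p"
    using p(4) ws(3) assms(1) apply_lamps_one[OF ls] by auto
  have fy: "f y = word_value A (ls y)" if "y \<in> F" for y using that eq(1) assms(2) by auto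
  have "F \<subseteq> set p"
  proof
    fix y assume y: "y \<in> F"
    then have "ls y \<noteq> []" using fy assms(2) by auto
    then show "y \<in> set p" using p(1) by (auto simp: decorated_walk_def)
  qed
  moreover have "(\<Sum>y\<in>F. word_length A S\<^sub>A (f y)) \<le> (\<Sum>y\<in>set p. length (ls y))"
  proof -
    have "(\<Sum>y\<in>F. word_length A S\<^sub>A (f y)) \<le> (\<Sum>y\<in>F. length (ls y))"
      using fy A.word_length_le[OF ls] by (intro sum_mono) simp
    also have "\<dots> \<le> (\<Sum>y\<in>set p. length (ls y))"
      using \<open>F \<subseteq> set p\<close> by (intro sum_mono2) auto
    finally show ?thesis .
  qed
  ultimately show ?thesis
    using p ws(2) eq(2) by (intro exI[of _ p]) (auto simp: decorated_walk_def)
qed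

section \<open>Deep dead ends in the wreath product\<close>

lemma locally_longest_ne_one:
  assumes "\<not> trivial_group A" "a \<in> carrier A"
    and "\<And>s. s \<in> S\<^sub>A \<Longrightarrow> word_length A S\<^sub>A (a \<otimes>\<^bsub>A\<^esub> s) \<le> word_length A S\<^sub>A a"
  shows "a \<noteq> \<one>\<^bsub>A\<^esub>"
proof
  assume a: "a = \<one>\<^bsub>A\<^esub>"
  \<comment> \<open>If \<open>a\<close> is trivial, every generator has length 0, so its geodesic
    word is empty.\<close>
  have "s = \<one>\<^bsub>A\<^esub>" if "s \<in> S\<^sub>A" for s
  proof -
    have s: "s \<in> carrier A" using that S_A by blast
    obtain l where "length l = word_length A S\<^sub>A s" "word_value A l = s"
      using A.geodesic_word[OF gen_A s] by blast
    then show ?thesis using assms(3)[OF that] a s by simp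
  qed
  then have "S\<^sub>A \<subseteq> {\<one>\<^bsub>A\<^esub>}" by blast
  then have "generate A S\<^sub>A \<subseteq> {\<one>\<^bsub>A\<^esub>}"
    using A.mono_generate A.generate_one by metis
  then show False
    using gen_A assms(1) A.trivial_group_subset by (auto simp: finite_symmetric_generating_set_def)
qed

text \<open>The upper bound for the modified element is compared with the lower bound for
  \<open>(f, x)\<close> over the same set \<open>F\<close>. The lower bound applies because
  \<open>a\<close> is non-trivial, which makes \<open>F\<close> the exact support of
  \<open>f\<close>.\<close>

lemma dead_end_wreath_product:
  assumes "finite F" "F \<subseteq> carrier B" "graph_ball \<Gamma> \<one>\<^bsub>B\<^esub> (k + n) \<subseteq> F"
    and x: "x \<in> graph_ball \<Gamma> \<one>\<^bsub>B\<^esub> k"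
    and max: "\<And>y. y \<in> graph_ball \<Gamma> \<one>\<^bsub>B\<^esub> (k + n) \<Longrightarrow> TS \<Gamma> \<one>\<^bsub>B\<^esub> y F \<le> TS \<Gamma> \<one>\<^bsub>B\<^esub> x F"
    and finite: "\<And>y. y \<in> F \<Longrightarrow> TS \<Gamma> \<one>\<^bsub>B\<^esub> y F \<noteq> \<infinity>"
    and a: "a \<in> carrier A" "a \<noteq> \<one>\<^bsub>A\<^esub>"
    and deep: "\<And>l. l \<in> lists S\<^sub>A \<Longrightarrow> length l \<le> n \<Longrightarrow>
      word_length A S\<^sub>A (a \<otimes>\<^bsub>A\<^esub> word_value A l) \<le> word_length A S\<^sub>A a"
  defines "f \<equiv> \<lambda>y\<in>carrier B. if y \<in> F then a else \<one>\<^bsub>A\<^esub>"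
  shows "(f, x) \<in> carrier W"
    and "\<And>ws. ws \<in> lists U \<Longrightarrow> length ws \<le> n \<Longrightarrow>
      word_length W U ((f, x) \<otimes>\<^bsub>W\<^esub> word_value W ws) \<le> word_length W U (f, x)"
proof -
  have "x \<in> F" using x assms(3) graph_ball_mono[of k "k + n"] by force
  have "finite {y \<in> carrier B. f y \<noteq> \<one>\<^bsub>A\<^esub>}"
    by (rule finite_subset[OF _ assms(1)]) (auto simp: f_def)
  then show fx: "(f, x) \<in> carrier W"
    using a(1) assms(2) \<open>x \<in> F\<close> by (auto simp: carrier_W_iff f_def)
  fix ws assume ws: "ws \<in> lists U" "length ws \<le> n"
  obtain q ls where q: "decorated_walk q ls" "hd q = x"
    "(\<Sum>y\<in>set q. length (ls y)) + length q = Suc (length ws)"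
    "(f, x) \<otimes>\<^bsub>W\<^esub> word_value W ws = (apply_lamps f ls, last q)"
    using word_to_decorated_walk[OF ws(1) fx] by blast
  have ls: "ls y \<in> lists S\<^sub>A" for y using q(1) by (auto simp: decorated_walk_def)
  have wq: "vwalk q \<Gamma>" "q \<noteq> []" using q(1) by (auto simp: decorated_walk_def)
  \<comment> \<open>At most \<open>n\<close> of the letters are moves, so the cursor stays in the
    ball of radius \<open>k + n\<close>.\<close>
  have "length q \<le> Suc n" using q(3) ws(2) by simp
  then have "k + (length q - 1) \<le> k + n" by simp
  then have ball: "set q \<subseteq> graph_ball \<Gamma> \<one>\<^bsub>B\<^esub> (k + n)"
    using vwalk_subset_graph_ball[OF wq(1), of "\<one>\<^bsub>B\<^esub>" k] x q(2)
    by (meson graph_ball_mono order.trans)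
  have lq: "last q \<in> graph_ball \<Gamma> \<one>\<^bsub>B\<^esub> (k + n)" using ball wq(2) by auto
  \<comment> \<open>No single lamp receives more than \<open>n\<close> letters, so the depth of
    \<open>a\<close> applies to each lamp separately.\<close>
  have len: "length (ls y) \<le> n" for y
  proof (cases "y \<in> set q")
    case True
    then have "length (ls y) \<le> (\<Sum>y\<in>set q. length (ls y))" by (intro member_le_sum) auto
    moreover have "length q \<ge> 1" using wq(2) by (cases q) auto
    ultimately show ?thesis using q(3) ws(2) by linarith
  qed (use q(1) in \<open>auto simp: decorated_walk_def\<close>)
  let ?g = "apply_lamps f ls"
  have g: "(?g, last q) \<in> carrier W"
  proof -
    have "word_value W ws \<in> carrier W" using ws(1) lists_U by (intro W.word_value_closed) blast
    then have "(f, x) \<otimes>\<^bsub>W\<^esub> word_value W ws \<in> carrier W" by (rule W.m_closed[OF fx])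
    then show ?thesis using q(4) by simp
  qed
  have out: "?g y = \<one>\<^bsub>A\<^esub>" if "y \<in> carrier B - F" for y
  proof -
    have "y \<notin> set q" using that ball assms(3) by blast
    then show ?thesis using that q(1) by (auto simp: apply_lamps_def f_def decorated_walk_def)
  qed
  obtain r where r: "vwalk r \<Gamma>" "hd r = \<one>\<^bsub>B\<^esub>" "last r = last q" "F \<subseteq> set r"
    "TS \<Gamma> \<one>\<^bsub>B\<^esub> (last q) F = enat (length r)"
    using TS_attained[OF finite, of "last q"] lq assms(3) by blast
  have supp: "F \<subseteq> {y \<in> carrier B. f y \<noteq> \<one>\<^bsub>A\<^esub>}" using assms(2) a by (auto simp: f_def)
  obtain p where p: "vwalk p \<Gamma>" "hd p = \<one>\<^bsub>B\<^esub>" "last p = x" "F \<subseteq> set p"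
    "(\<Sum>y\<in>F. word_length A S\<^sub>A (f y)) + length p \<le> Suc (word_length W U (f, x))"
    using word_length_W_lower[OF fx supp] by blast
  \<comment> \<open>\<open>r\<close> realises \<open>TS\<close> at the new cursor, which is at most
    \<open>TS\<close> at \<open>x\<close>, while \<open>p\<close> is a competitor for the
    latter.\<close>
  have "enat (length r) \<le> enat (length p)"
    using max[OF lq] TS_le[OF p(1-4)] r(5) by (metis order.trans)
  moreover have "(\<Sum>y\<in>F. word_length A S\<^sub>A (?g y)) \<le> (\<Sum>y\<in>F. word_length A S\<^sub>A (f y))"
    using deep[OF ls len] assms(2) by (intro sum_mono) (auto simp: apply_lamps_def f_def)
  moreover note word_length_W_upper[OF g assms(2) out r(1-4)] p(5)
  ultimately have "word_length W U (?g, last q) \<le> word_length W U (f, x)" by simp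
  then show "word_length W U ((f, x) \<otimes>\<^bsub>W\<^esub> word_value W ws) \<le> word_length W U (f, x)"
    using q(4) by simp
qed

lemma unbounded_depth_wreath_product:
  assumes "quasi_hamiltonian \<Gamma> \<one>\<^bsub>B\<^esub>" "\<not> trivial_group A" "unbounded_depth A S\<^sub>A"
  shows "unbounded_depth W U"
  unfolding W.unbounded_depth_iff[OF U]
proof
  fix n
  obtain \<F> M where \<F>: "\<And>F. F \<in> \<F> \<Longrightarrow> induced_subgraph F \<Gamma> \<and> finite (verts F)"
    "\<And>n. n \<ge> 1 \<Longrightarrow> \<exists>F\<in>\<F>. graph_ball \<Gamma> \<one>\<^bsub>B\<^esub> n \<subseteq> verts F"
    "\<And>F x. F \<in> \<F> \<Longrightarrow> x \<in> verts F \<Longrightarrow>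
      TS \<Gamma> \<one>\<^bsub>B\<^esub> x (verts F) \<le> enat (card (verts F) + M)"
    using assms(1) unfolding quasi_hamiltonian_def by metis
  \<comment> \<open>The radius covers all balls of radius \<open>k * n\<close> with \<open>k\<close>
    up to \<open>M + 1\<close>; the outer \<open>Suc\<close> keeps it positive when \<open>n\<close>
    is 0.\<close>
  obtain H where H: "H \<in> \<F>" "graph_ball \<Gamma> \<one>\<^bsub>B\<^esub> (Suc (Suc M * n)) \<subseteq> verts H"
    using \<F>(2)[of "Suc (Suc M * n)"] by auto
  define F where "F = verts H"
  have F: "finite F" "F \<subseteq> carrier B"
    using \<F>(1)[OF H(1)] by (auto simp: F_def induced_subgraph_def subgraph_def)
  define D where "D k = graph_ball \<Gamma> \<one>\<^bsub>B\<^esub> (k * n)" for k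
  have D: "D k \<subseteq> F" if "k \<le> Suc M" for k
  proof -
    have "k * n \<le> Suc (Suc M * n)" using mult_le_mono1[OF that, of n] by simp
    from graph_ball_mono[OF this, of \<Gamma> "\<one>\<^bsub>B\<^esub>"] H(2) show ?thesis
      unfolding D_def F_def by (rule order.trans)
  qed
  \<comment> \<open>\<open>TS\<close> is finite on \<open>F\<close>, so \<open>the_enat\<close>
    loses nothing there and \<open>t\<close> can be used in the growth argument on
    \<open>nat\<close>.\<close>
  define t where "t x = the_enat (TS \<Gamma> \<one>\<^bsub>B\<^esub> x F)" for x
  have fin: "TS \<Gamma> \<one>\<^bsub>B\<^esub> x F \<noteq> \<infinity>" if "x \<in> F" for x
    using \<F>(3)[OF H(1), of x] that by (metis F_def enat_ord_code(5) infinity_ileE)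
  then have t: "TS \<Gamma> \<one>\<^bsub>B\<^esub> x F = enat (t x)" if "x \<in> F" for x
    unfolding t_def using that by fastforce
  have "\<one>\<^bsub>B\<^esub> \<in> D 0"
    unfolding D_def graph_ball_def by (auto intro!: exI[of _ "[\<one>\<^bsub>B\<^esub>]"])
  moreover have "card F \<le> t \<one>\<^bsub>B\<^esub>"
    using TS_ge_card[of F \<Gamma> "\<one>\<^bsub>B\<^esub>" "\<one>\<^bsub>B\<^esub>"] t D[of 0] \<open>\<one>\<^bsub>B\<^esub> \<in> D 0\<close> by auto
  moreover have "t x \<le> card F + M" if "k \<le> Suc M" "x \<in> D k" for k x
    using \<F>(3)[OF H(1), of x] t[of x] D[OF that(1)] that(2) unfolding F_def by auto
  ultimately obtain k x where k: "k \<le> M" "x \<in> D k" "\<And>y. y \<in> D (Suc k) \<Longrightarrow> t y \<le> t x"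
    using bounded_growth_maximum[of "\<one>\<^bsub>B\<^esub>" D "card F" t M] by blast
  have DS: "graph_ball \<Gamma> \<one>\<^bsub>B\<^esub> (k * n + n) = D (Suc k)" by (simp add: D_def add.commute)
  have "x \<in> F" using k D[of k] by auto
  have DF: "D (Suc k) \<subseteq> F" using D[of "Suc k"] k(1) by simp
  \<comment> \<open>Length \<open>Suc n\<close> instead of \<open>n\<close> includes single letters
    even for \<open>n = 0\<close>, which is what shows that \<open>a\<close> is non-trivial.\<close>
  obtain a where a: "a \<in> carrier A"
    "\<And>l. l \<in> lists S\<^sub>A \<Longrightarrow> length l \<le> Suc n \<Longrightarrow>
      word_length A S\<^sub>A (a \<otimes>\<^bsub>A\<^esub> word_value A l) \<le> word_length A S\<^sub>A a"
    using A.unbounded_depth_iff[OF S_A] assms(3) by meson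
  have "word_length A S\<^sub>A (a \<otimes>\<^bsub>A\<^esub> s) \<le> word_length A S\<^sub>A a" if "s \<in> S\<^sub>A" for s
    using a(2)[of "[s]"] that S_A by auto
  then have "a \<noteq> \<one>\<^bsub>A\<^esub>" using locally_longest_ne_one assms(2) a(1) by blast
  have "TS \<Gamma> \<one>\<^bsub>B\<^esub> y F \<le> TS \<Gamma> \<one>\<^bsub>B\<^esub> x F" if "y \<in> D (Suc k)" for y
    using t[of y] t[OF \<open>x \<in> F\<close>] k(3)[OF that] DF that by auto
  note deep = dead_end_wreath_product[OF F, where k = "k * n" and n = n and x = x and a = a,
      unfolded DS, OF DF k(2)[unfolded D_def] this fin a(1) \<open>a \<noteq> \<one>\<^bsub>A\<^esub>\<close> a(2)[OF _ le_SucI]]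
  show "\<exists>g\<in>carrier W. \<forall>ws\<in>lists U. length ws \<le> n \<longrightarrow>
      word_length W U (g \<otimes>\<^bsub>W\<^esub> word_value W ws) \<le> word_length W U g"
    by (rule bexI[OF _ deep(1)]) (use deep(2) in blast)+
qed

end

theorem lemma4p5:
  fixes A :: "('a, 'k) monoid_scheme" and B :: "('b, 'm) monoid_scheme"
    and S\<^sub>A :: "'a set" and S\<^sub>B :: "'b set"
  assumes "group B" and "infinite (carrier B)"
    and "finite_symmetric_generating_set B S\<^sub>B"
    and "quasi_hamiltonian (cayley_graph B S\<^sub>B) \<one>\<^bsub>B\<^esub>"
    and "group A" and "\<not> trivial_group A"
    and "finite_symmetric_generating_set A S\<^sub>A"
    and "unbounded_depth A S\<^sub>A"
  shows "unbounded_depth (wreath_product A B)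
           (wreath_lamp A B ` S\<^sub>A \<union> wreath_move A B ` S\<^sub>B)"
proof -
  interpret lamplighter A B S\<^sub>A S\<^sub>B
    using assms by (simp add: lamplighter_def lamplighter_axioms_def)
  show ?thesis using assms(4,6,8) by (rule unbounded_depth_wreath_product)
qed

end
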